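(* There is an absolute constant $c>0$ such that for every $n \geq 1$ there exist four $n$-pencils in the real projective plane whose centres are in general position (no three of the four centres are collinear) and which determine at least $c\, n^{3/2}$ $4$-rich points.
   Context: An $n$-pencil with centre $p \in P^2(\mathbb{R})$ is a set of $n$ distinct concurrent lines all passing through $p$. Given four pencils, a point is called $4$-rich if it lies on at least one line from each of the four pencils. *)

theory Defs
  imports "HOL-Analysis.Analysis"
begin

text \<open>
  The real projective plane is modelled as the projectivisation of \<^typ>\<open>real ^ 3\<close>: its points are
  the one-dimensional linear subspaces, its lines the two-dimensional ones, and a point lies on a
  line iff it is contained in it as a subspace.
\<close>

definition proj_points :: "(real ^ 3) set set" where
  "proj_points = {P. subspace P \<and> dim P = 1}"

definition proj_lines :: "(real ^ 3) set set" where
  "proj_lines = {L. subspace L \<and> dim L = 2}"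

definition proj_collinear :: "(real ^ 3) set \<Rightarrow> (real ^ 3) set \<Rightarrow> (real ^ 3) set \<Rightarrow> bool" where
  "proj_collinear P Q R \<longleftrightarrow> (\<exists>L\<in>proj_lines. P \<subseteq> L \<and> Q \<subseteq> L \<and> R \<subseteq> L)"

definition is_pencil :: "nat \<Rightarrow> (real ^ 3) set \<Rightarrow> (real ^ 3) set set \<Rightarrow> bool" where
  "is_pencil n P \<L> \<longleftrightarrow>
     P \<in> proj_points \<and> \<L> \<subseteq> proj_lines \<and> (\<forall>L\<in>\<L>. P \<subseteq> L) \<and> finite \<L> \<and> card \<L> = n"

text \<open>
  Families of four objects are indexed by \<open>{..<4}\<close>; values at other indices are irrelevant.
  Since any two points lie on a common line, general position forces the four centres to be
  pairwise distinct.
\<close>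

definition general_position4 :: "(nat \<Rightarrow> (real ^ 3) set) \<Rightarrow> bool" where
  "general_position4 p \<longleftrightarrow>
     (\<forall>i<4. \<forall>j<4. \<forall>k<4. i \<noteq> j \<and> j \<noteq> k \<and> i \<noteq> k \<longrightarrow> \<not> proj_collinear (p i) (p j) (p k))"

definition rich4_points :: "(nat \<Rightarrow> (real ^ 3) set set) \<Rightarrow> (real ^ 3) set set" where
  "rich4_points \<L> = {P \<in> proj_points. \<forall>i<4. \<exists>L\<in>\<L> i. P \<subseteq> L}"

end

theory Submission imports Defs begin

text \<open>
  Take the frame \<open>e\<^sub>1, e\<^sub>2, e\<^sub>3, (1,1,1)\<close> as centres and the points \<open>[a:b:c]\<close> with integers
  \<open>1 \<le> a, b, c \<le> m\<close>, where \<open>m\<close> is about \<open>\<surd>n / 2\<close>. The line through a centre \<open>q\<close> and a point \<open>x\<close> has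
  normal vector \<open>q \<times> x\<close>, which depends only on two of \<open>a, b, c\<close> or, for \<open>q = (1,1,1)\<close>, on two of
  their differences. So \<open>(2m - 1)\<^sup>2 \<le> n\<close> lines per pencil suffice to cover all these points, and
  the coprime triples, at least \<open>m\<^sup>3 / 2\<close> in number, give distinct points.
\<close>

section \<open>Counting coprime triples\<close>

definition coprime_triples :: "nat \<Rightarrow> (nat \<times> nat \<times> nat) set" where
  "coprime_triples m =
     {(a, b, c). a \<in> {1..m} \<and> b \<in> {1..m} \<and> c \<in> {1..m} \<and> gcd a (gcd b c) = 1}"

lemma finite_coprime_triples: "finite (coprime_triples m)"
  by (rule finite_subset[of _ "{1..m} \<times> {1..m} \<times> {1..m}"]) (auto simp: coprime_triples_def)

text \<open>The sum is dominated by a telescoping one: \<open>2k \<le> (k + 1)^2\<close> gives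
  \<open>1/(k+1)^3 \<le> (1/k - 1/(k+1)) / 2\<close>. What matters later is the resulting bound 1/2,
  uniform in \<open>k\<close>.\<close>

lemma sum_inverse_cubes_le:
  assumes "k \<ge> 1"
  shows "(\<Sum>d = 2..k. 1 / real d ^ 3) \<le> (1 - 1 / real k) / 2"
  using assms
proof (induction k rule: dec_induct)
  case (step k)
  have k: "real k \<ge> 1" using step.hyps by simp
  have "2 * (real k * (1 + real k)) \<le> (1 + real k) ^ 3"
  proof -
    have "(1 + real k) ^ 3 - 2 * (real k * (1 + real k)) = (1 + real k) * (1 + real k ^ 2)"
      by (simp add: power2_eq_square power3_eq_cube algebra_simps)
    moreover have "\<dots> \<ge> 0" by simp
    ultimately show ?thesis by linarith
  qed
  then have "1 / (1 + real k) ^ 3 \<le> 1 / (2 * (real k * (1 + real k)))"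
    using k by (intro divide_left_mono) auto
  also have "\<dots> = (1 / real k - 1 / (1 + real k)) / 2"
    using k by (simp add: field_simps)
  finally have "1 / real (Suc k) ^ 3 \<le> (1 / real k - 1 / real (Suc k)) / 2" by simp
  moreover have "(\<Sum>d = 2..Suc k. 1 / real d ^ 3) = (\<Sum>d = 2..k. 1 / real d ^ 3) + 1 / real (Suc k) ^ 3"
    using step.hyps by simp
  ultimately show ?case using step.IH by argo
qed simp

text \<open>Every triple in the cube of side \<open>m\<close> is its gcd \<open>d\<close> times a
  triple in the cube of side \<open>m div d\<close>. A union bound over \<open>d \<ge> 2\<close>
  shows that the non-coprime triples number at most \<open>m^3\<close> times the sum of
  \<open>1/d^3\<close>, hence at most half of the cube.\<close>

lemma card_coprime_triples_ge:
  assumes "m \<ge> 1"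
  shows "real m ^ 3 / 2 \<le> real (card (coprime_triples m))"
proof -
  define cube :: "nat \<Rightarrow> (nat \<times> nat \<times> nat) set" where "cube k = {1..k} \<times> {1..k} \<times> {1..k}" for k
  define scale :: "nat \<Rightarrow> nat \<times> nat \<times> nat \<Rightarrow> nat \<times> nat \<times> nat"
    where "scale d = (\<lambda>(a, b, c). (d * a, d * b, d * c))" for d
  have card_cube: "card (cube k) = k ^ 3" for k
    by (simp add: cube_def card_cartesian_product power3_eq_cube)
  have fin: "finite (cube k)" for k
    by (simp add: cube_def)
  have "cube m \<subseteq> coprime_triples m \<union> (\<Union>d\<in>{2..m}. scale d ` cube (m div d))"
  proof
    fix t assume "t \<in> cube m"
    then obtain a b c where t: "t = (a, b, c)" "a \<in> {1..m}" "b \<in> {1..m}" "c \<in> {1..m}"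
      by (auto simp: cube_def)
    define d where "d = gcd a (gcd b c)"
    show "t \<in> coprime_triples m \<union> (\<Union>d\<in>{2..m}. scale d ` cube (m div d))"
    proof (cases "d = 1")
      case True
      then show ?thesis using t by (auto simp: coprime_triples_def d_def)
    next
      case False
      have "d \<noteq> 0" using t by (auto simp: d_def)
      have "d dvd a" "d dvd b" "d dvd c"
        by (auto simp: d_def intro: dvd_trans[OF gcd_dvd2])
      then obtain a' b' c' where abc: "a = d * a'" "b = d * b'" "c = d * c'"
        by (auto elim!: dvdE)
      have "d \<le> m" using \<open>d dvd a\<close> t by (auto dest: dvd_imp_le)
      moreover have "(a', b', c') \<in> cube (m div d)"
        using t abc \<open>d \<noteq> 0\<close> by (auto simp: cube_def less_eq_div_iff_mult_less_eq ac_simps)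
      moreover have "t = scale d (a', b', c')"
        using abc t by (simp add: scale_def)
      ultimately show ?thesis using False \<open>d \<noteq> 0\<close> by (intro UnI2 UN_I[of d]) auto
    qed
  qed
  then have "card (cube m) \<le> card (coprime_triples m \<union> (\<Union>d\<in>{2..m}. scale d ` cube (m div d)))"
    using fin finite_coprime_triples by (intro card_mono) auto
  also have "\<dots> \<le> card (coprime_triples m) + card (\<Union>d\<in>{2..m}. scale d ` cube (m div d))"
    by (rule card_Un_le)
  also have "card (\<Union>d\<in>{2..m}. scale d ` cube (m div d)) \<le> (\<Sum>d = 2..m. card (scale d ` cube (m div d)))"
    by (rule card_UN_le) simp
  also have "\<dots> \<le> (\<Sum>d = 2..m. (m div d) ^ 3)"
    by (intro sum_mono order_trans[OF card_image_le[OF fin]]) (simp add: card_cube)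
  finally have "m ^ 3 \<le> card (coprime_triples m) + (\<Sum>d = 2..m. (m div d) ^ 3)"
    by (simp add: card_cube)
  then have "real m ^ 3 \<le> real (card (coprime_triples m)) + (\<Sum>d = 2..m. real (m div d) ^ 3)"
    by (metis (no_types, lifting) of_nat_add of_nat_le_iff of_nat_power of_nat_sum sum.cong)
  also have "(\<Sum>d = 2..m. real (m div d) ^ 3) \<le> (\<Sum>d = 2..m. real m ^ 3 * (1 / real d ^ 3))"
  proof (rule sum_mono)
    fix d
    have "real (m div d) ^ 3 \<le> (real m / real d) ^ 3"
      by (intro power_mono of_nat_div_le_of_nat) simp
    then show "real (m div d) ^ 3 \<le> real m ^ 3 * (1 / real d ^ 3)"
      by (simp add: power_divide)
  qed
  also have "\<dots> = real m ^ 3 * (\<Sum>d = 2..m. 1 / real d ^ 3)"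
    by (simp add: sum_distrib_left)
  also have "\<dots> \<le> real m ^ 3 * (1 / 2)"
  proof (rule mult_left_mono)
    show "(\<Sum>d = 2..m. 1 / real d ^ 3) \<le> 1 / 2"
      using sum_inverse_cubes_le[OF assms] by (rule order_trans) simp
  qed simp
  finally show ?thesis by simp
qed

section \<open>Coprime triples as projective points\<close>

definition triple_vec :: "nat \<times> nat \<times> nat \<Rightarrow> real ^ 3" where
  "triple_vec = (\<lambda>(a, b, c). vector [real a, real b, real c])"

lemma inj_on_span_coprime_triples:
  "inj_on (\<lambda>t. span {triple_vec t}) (coprime_triples m)"
proof (rule inj_onI)
  fix s t
  assume s: "s \<in> coprime_triples m" and t: "t \<in> coprime_triples m"
    and eq: "span {triple_vec s} = span {triple_vec t}"
  obtain a b c where abc: "s = (a, b, c)" "a \<ge> 1" "gcd a (gcd b c) = 1"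
    using s by (auto simp: coprime_triples_def)
  obtain a' b' c' where abc': "t = (a', b', c')" "gcd a' (gcd b' c') = 1"
    using t by (auto simp: coprime_triples_def)
  have "triple_vec t \<in> span {triple_vec s}"
    unfolding eq by (simp add: span_base)
  then obtain r where "triple_vec t = r *\<^sub>R triple_vec s"
    by (auto simp: span_singleton)
  then have r: "real a' = r * real a" "real b' = r * real b" "real c' = r * real c"
    by (auto simp: triple_vec_def abc abc' vec_eq_iff forall_3)
  \<comment> \<open>Cross-multiplying eliminates the real factor \<open>r\<close> and leaves
    equations between natural numbers.\<close>
  have "real (a' * b) = real (a * b')" "real (a' * c) = real (a * c')"
    using r by simp_all
  then have eqs: "a' * b = a * b'" "a' * c = a * c'"
    using of_nat_eq_iff by blast+
  \<comment> \<open>Both triples have gcd 1, so moving \<open>a'\<close> into one gcd and pulling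
    \<open>a\<close> out of the other gives \<open>a' = a\<close>. As \<open>a \<ge> 1\<close>, it
    then cancels in \<open>eqs\<close>.\<close>
  have "a' = a' * gcd a (gcd b c)" using abc by simp
  also have "\<dots> = gcd (a * a') (gcd (a * b') (a * c'))"
    by (simp add: gcd_mult_distrib_nat eqs mult.commute)
  also have "\<dots> = a * gcd a' (gcd b' c')"
    by (simp add: gcd_mult_distrib_nat)
  finally have "a' = a" using abc' by simp
  then show "s = t" using eqs abc abc' by simp
qed

section \<open>Pencils\<close>

lemma hyperplane_in_proj_lines:
  assumes "w \<noteq> (0 :: real ^ 3)"
  shows "{v. w \<bullet> v = 0} \<in> proj_lines"
  using assms by (simp add: proj_lines_def subspace_hyperplane dim_hyperplane)

lemma span_in_proj_points:
  assumes "x \<noteq> (0 :: real ^ 3)"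
  shows "span {x} \<in> proj_points"
  using assms by (simp add: proj_points_def)

lemma span_singleton_subset_hyperplane_iff: "span {x} \<subseteq> {v. w \<bullet> v = 0} \<longleftrightarrow> w \<bullet> x = 0"
  using span_minimal[OF _ subspace_hyperplane, of "{x}" w] span_base[of x "{x}"] by auto

lemma cross_zero_imp_in_span:
  assumes "cross3 p x = 0" "p \<noteq> 0"
  shows "x \<in> span {p}"
proof -
  have "collinear {0, p, x}" using assms by (simp add: cross_eq_0)
  then show ?thesis using assms by (auto simp: collinear_lemma span_singleton)
qed

text \<open>Supplies spare lines for filling a pencil up to exactly \<open>n\<close>. The lines
  through \<open>p\<close> cover the whole space, since a vector \<open>x\<close> not parallel to
  \<open>p\<close> lies in the plane with normal \<open>cross3 p x\<close>; finitely many planes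
  form a null set and cannot do so.\<close>

lemma infinite_lines_through_point:
  assumes "p \<noteq> (0 :: real ^ 3)"
  shows "infinite {L \<in> proj_lines. span {p} \<subseteq> L}" (is "infinite ?A")
proof
  assume fin: "finite ?A"
  have "UNIV \<subseteq> \<Union>?A \<union> span {p}"
  proof
    fix x
    show "x \<in> \<Union>?A \<union> span {p}"
    proof (cases "cross3 p x = 0")
      case True
      then show ?thesis using cross_zero_imp_in_span assms by blast
    next
      case False
      then have "{v. cross3 p x \<bullet> v = 0} \<in> ?A"
        by (auto simp: hyperplane_in_proj_lines span_singleton_subset_hyperplane_iff dot_cross_self)
      moreover have "x \<in> {v. cross3 p x \<bullet> v = 0}" by (simp add: dot_cross_self)
      ultimately show ?thesis by blast
    qed
  qed
  moreover have "negligible (\<Union>?A \<union> span {p})"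
  proof (intro negligible_Un negligible_Union fin)
    show "negligible L" if "L \<in> ?A" for L
      using that by (intro negligible_lowdim) (simp add: proj_lines_def)
    show "negligible (span {p})"
      using assms by (intro negligible_lowdim) simp
  qed
  ultimately have "negligible (UNIV :: (real ^ 3) set)"
    using negligible_subset by blast
  then show False by simp
qed

text \<open>The line joining \<open>p\<close> to \<open>x\<close> is determined by its normal
  \<open>cross3 p x\<close>, so the number of distinct normals bounds the number of lines that must
  be present. Arbitrary further lines through \<open>p\<close> bring the count to
  \<open>n\<close>.\<close>

lemma pencil_covering_exists:
  assumes "p \<noteq> 0" "finite X" "card (cross3 p ` X) \<le> n" "n \<ge> 1"
  shows "\<exists>\<L>. is_pencil n (span {p}) \<L> \<and> (\<forall>x\<in>X. \<exists>L\<in>\<L>. span {x} \<subseteq> L)"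
proof -
  define A where "A = {L \<in> proj_lines. span {p} \<subseteq> L}"
  \<comment> \<open>The zero vector is removed because its orthogonal complement is the whole space,
    not a line; it arises from vectors parallel to \<open>p\<close>.\<close>
  define K where "K = (\<lambda>w. {v. w \<bullet> v = 0}) ` (cross3 p ` X - {0})"
  have infA: "infinite A"
    unfolding A_def by (rule infinite_lines_through_point[OF assms(1)])
  have finK: "finite K" using assms(2) by (simp add: K_def)
  have KA: "K \<subseteq> A"
  proof
    fix L assume "L \<in> K"
    then obtain w x where w: "L = {v. w \<bullet> v = 0}" "w \<noteq> 0" "w = cross3 p x"
      by (auto simp: K_def)
    then have "span {p} \<subseteq> L"
      by (simp only: span_singleton_subset_hyperplane_iff dot_cross_self)
    then show "L \<in> A" using w(1,2) by (simp add: A_def hyperplane_in_proj_lines)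
  qed
  have "card K \<le> card (cross3 p ` X - {0})"
    unfolding K_def using assms(2) by (intro card_image_le) auto
  also have "\<dots> \<le> n" using card_Diff1_le assms(3) by (rule order_trans)
  finally have "card K \<le> n" .
  have "infinite (A - K)" using infA finK by simp
  then obtain B where B: "finite B" "card B = n - card K" "B \<subseteq> A - K"
    using infinite_arbitrarily_large by blast
  have card: "card (K \<union> B) = n"
    using B finK \<open>card K \<le> n\<close> by (subst card_Un_disjoint) auto
  have "is_pencil n (span {p}) (K \<union> B)"
    using B KA finK card span_in_proj_points[OF assms(1)] by (auto simp: is_pencil_def A_def)
  moreover have "\<exists>L\<in>K \<union> B. span {x} \<subseteq> L" if "x \<in> X" for x
  proof (cases "cross3 p x = 0")
    case True
    \<comment> \<open>Here \<open>x\<close> is a multiple of \<open>p\<close>, hence on every line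
      of the pencil; \<open>n \<ge> 1\<close> guarantees that there is one.\<close>
    have "K \<union> B \<noteq> {}" using card assms(4) by auto
    then obtain L where "L \<in> K \<union> B" by blast
    moreover from this have "span {p} \<subseteq> L" using B KA by (auto simp: A_def)
    moreover have "span {x} \<subseteq> span {p}"
      using cross_zero_imp_in_span[OF True assms(1)] by (intro span_minimal) auto
    ultimately show ?thesis by blast
  next
    case False
    then have "{v. cross3 p x \<bullet> v = 0} \<in> K" using that by (auto simp: K_def)
    moreover have "span {x} \<subseteq> {v. cross3 p x \<bullet> v = 0}"
      by (simp add: span_singleton_subset_hyperplane_iff dot_cross_self)
    ultimately show ?thesis by blast
  qed
  ultimately show ?thesis by blast
qed

section \<open>Finiteness of the set of rich points\<close>

lemma point_eq_inter_lines:
  assumes "P \<in> proj_points" "A \<in> proj_lines" "B \<in> proj_lines" "A \<noteq> B" "P \<subseteq> A" "P \<subseteq> B"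
  shows "P = A \<inter> B"
proof -
  have sub: "subspace P" "subspace A" "subspace B" "subspace (A \<inter> B)"
    using assms by (auto simp: proj_points_def proj_lines_def subspace_inter)
  have dims: "dim P = 1" "dim A = 2" "dim B = 2"
    using assms by (auto simp: proj_points_def proj_lines_def)
  have "dim (A \<inter> B) \<le> 1"
  proof (rule ccontr)
    \<comment> \<open>An intersection of dimension 2 would fill both planes and force
      \<open>A = B\<close>.\<close>
    assume "\<not> dim (A \<inter> B) \<le> 1"
    then have "A \<inter> B = A" "A \<inter> B = B"
      using sub dims by (intro subspace_dim_equal; simp)+
    then show False using assms(4) by blast
  qed
  then show ?thesis using sub dims assms by (intro subspace_dim_equal) auto
qed

text \<open>
  Needed because \<^const>\<open>card\<close> is \<open>0\<close> on infinite sets. Without general position it fails: a common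
  line of all four pencils consists of rich points.
\<close>

lemma finite_rich4_points:
  assumes "\<forall>i<4. is_pencil n (p i) (\<L> i)" "general_position4 p"
  shows "finite (rich4_points \<L>)"
proof -
  define U where "U = (\<Union>i<4. \<L> i)"
  have "finite U" using assms(1) by (auto simp: U_def is_pencil_def)
  have "rich4_points \<L> \<subseteq> (\<lambda>(A, B). A \<inter> B) ` (U \<times> U)"
  proof
    fix P assume "P \<in> rich4_points \<L>"
    then have P: "P \<in> proj_points" and ex: "\<forall>i<4. \<exists>L\<in>\<L> i. P \<subseteq> L"
      by (auto simp: rich4_points_def)
    then obtain L where L: "L i \<in> \<L> i" "P \<subseteq> L i" if "i < 4" for i
      by metis
    have line: "L i \<in> proj_lines" "p i \<subseteq> L i" "L i \<in> U" if "i < 4" for i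
      using that L[OF that] assms(1) by (auto simp: is_pencil_def U_def)
    \<comment> \<open>If the lines chosen for \<open>P\<close> from the first three pencils
      coincided, that line would contain three centres. So two chosen lines differ and determine
      \<open>P\<close>, leaving at most one rich point per pair from \<open>U\<close>.\<close>
    have "\<not> proj_collinear (p 0) (p 1) (p 2)"
      using assms(2) by (simp add: general_position4_def)
    then have "\<not> (L 0 = L 1 \<and> L 0 = L 2)"
      using line[of 0] line[of 1] line[of 2] by (auto simp: proj_collinear_def)
    then obtain j where j: "j < 4" "L 0 \<noteq> L j"
      by (metis one_less_numeral_iff semiring_norm(76) numeral_less_iff semiring_norm(78))
    then have "P = L 0 \<inter> L j"
      using P L[of 0] L[of j] line[of 0] line[of j] by (intro point_eq_inter_lines) auto
    then show "P \<in> (\<lambda>(A, B). A \<inter> B) ` (U \<times> U)"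
      using line[of 0] line[of j] j by auto
  qed
  then show ?thesis using \<open>finite U\<close> by (auto intro: finite_subset)
qed

section \<open>The construction\<close>

definition centre :: "nat \<Rightarrow> real ^ 3" where
  "centre i = [vector [1, 0, 0], vector [0, 1, 0], vector [0, 0, 1], vector [1, 1, 1]] ! i"

lemma centre_simps:
  "centre 0 = vector [1, 0, 0]" "centre (Suc 0) = vector [0, 1, 0]"
  "centre 2 = vector [0, 0, 1]" "centre 3 = vector [1, 1, 1]"
  by (simp_all add: centre_def eval_nat_numeral)

lemma less_4_cases: "(i::nat) < 4 \<longleftrightarrow> i = 0 \<or> i = Suc 0 \<or> i = 2 \<or> i = 3"
  by auto

lemma centre_nonzero: "i < 4 \<Longrightarrow> centre i \<noteq> 0"
  by (auto simp: less_4_cases centre_simps vec_eq_iff forall_3)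

text \<open>A line through three centres would have a nonzero normal orthogonal to three of the
  frame vectors, but any three of these are linearly independent.\<close>

lemma general_position_centres: "general_position4 (\<lambda>i. span {centre i})"
  unfolding general_position4_def
proof (intro allI impI notI)
  fix i j k :: nat
  assume ijk: "i < 4" "j < 4" "k < 4" "i \<noteq> j \<and> j \<noteq> k \<and> i \<noteq> k"
    and "proj_collinear (span {centre i}) (span {centre j}) (span {centre k})"
  then obtain L where L: "subspace L" "dim L = 2" "span {centre i} \<subseteq> L" "span {centre j} \<subseteq> L"
    "span {centre k} \<subseteq> L"
    by (auto simp: proj_collinear_def proj_lines_def)
  then obtain w :: "real ^ 3" where w: "w \<noteq> 0" "span L \<subseteq> {x. w \<bullet> x = 0}"
    using lowdim_subset_hyperplane[of L] by auto
  then have "L \<subseteq> {x. w \<bullet> x = 0}" using span_superset by blast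
  then have "w \<bullet> x = 0" if "span {x} \<subseteq> L" for x
    using that span_base[of x "{x}"] by blast
  then have "w \<bullet> centre i = 0" "w \<bullet> centre j = 0" "w \<bullet> centre k = 0"
    using L by blast+
  then have "w $ 1 = 0 \<and> w $ 2 = 0 \<and> w $ 3 = 0"
    using ijk by (auto simp: less_4_cases centre_simps inner_vec_def sum_3)
  then show False using w by (simp add: vec_eq_iff forall_3)
qed

lemma card_normals_le:
  assumes "i < 4" "m \<ge> 1"
  shows "card (cross3 (centre i) ` triple_vec ` coprime_triples m) \<le> (2 * m - 1)\<^sup>2"
proof -
  define I where "I = {1 - int m..int m - 1}"
  define J where "J = {1..int m}"
  \<comment> \<open>\<open>f\<close> rebuilds the normal from two integer parameters. For a unit
    vector these are the two coordinates other than the \<open>i\<close>-th; for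
    \<open>(1,1,1)\<close> the normal is \<open>(c - b, a - c, b - a)\<close>, whose entries sum to
    0, so the last two suffice.\<close>
  define f :: "int \<times> int \<Rightarrow> real ^ 3" where "f = (\<lambda>(s, t).
    [vector [0, - of_int t, of_int s], vector [of_int t, 0, - of_int s],
     vector [- of_int t, of_int s, 0], vector [- of_int s - of_int t, of_int s, of_int t]] ! i)"
  \<comment> \<open>Coordinates take \<open>m\<close> values, while differences of coordinates range
    over \<open>2 * m - 1\<close> values.\<close>
  define D where "D = (if i = 3 then I \<times> I else J \<times> J)"
  have "finite D" by (simp add: D_def I_def J_def)
  have "cross3 (centre i) ` triple_vec ` coprime_triples m \<subseteq> f ` D"
  proof clarify
    fix a b c assume "(a, b, c) \<in> coprime_triples m"
    then have abc: "1 \<le> a" "a \<le> m" "1 \<le> b" "b \<le> m" "1 \<le> c" "c \<le> m"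
      by (auto simp: coprime_triples_def)
    define u where "u = [(int b, int c), (int a, int c), (int a, int b), (int a - int c, int b - int a)] ! i"
    have "cross3 (centre i) (triple_vec (a, b, c)) = f u"
      using assms(1) unfolding less_4_cases
      by (elim disjE) (simp_all add: centre_simps u_def f_def triple_vec_def cross3_def nth_Cons')
    moreover have "u \<in> D"
      using assms(1) abc by (auto simp: less_4_cases u_def D_def I_def J_def nth_Cons')
    ultimately show "cross3 (centre i) (triple_vec (a, b, c)) \<in> f ` D" by blast
  qed
  then have "card (cross3 (centre i) ` triple_vec ` coprime_triples m) \<le> card D"
    using \<open>finite D\<close> by (rule surj_card_le[rotated])
  also have "\<dots> \<le> (2 * m - 1)\<^sup>2"
  proof -
    have "card I = 2 * m - 1" using assms(2) by (simp add: I_def)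
    moreover have "card J \<le> 2 * m - 1" using assms(2) by (simp add: J_def)
    ultimately show ?thesis
      by (auto simp: D_def card_cartesian_product power2_eq_square mult_le_mono)
  qed
  finally show ?thesis .
qed

lemma exists_grid_size:
  assumes "n \<ge> (1 :: nat)"
  shows "\<exists>m\<ge>1. (2 * m - 1)\<^sup>2 \<le> n \<and> real n powr (3 / 2) \<le> 27 * real m ^ 3"
proof -
  define s where "s = nat \<lfloor>sqrt n\<rfloor>"
  \<comment> \<open>Half of \<open>s\<close> rounded up is the largest \<open>m\<close> with
    \<open>2 * m - 1 \<le> s\<close>. Then \<open>s \<le> 2 * m\<close>, so
    \<open>s + 1 \<le> 3 * m\<close> once \<open>m \<ge> 1\<close>; cubing this 3 gives the constant
    27.\<close>
  define m where "m = (s + 1) div 2"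
  have s: "real s \<le> sqrt n" "sqrt n < real s + 1"
    unfolding s_def by (auto simp: le_nat_floor)
  have "sqrt n \<ge> 1" using assms by simp
  then have "s \<ge> 1" using s by linarith
  then have m: "m \<ge> 1" "2 * m - 1 \<le> s" "s + 1 \<le> 3 * m"
    by (auto simp: m_def)
  have "real (s\<^sup>2) \<le> (sqrt n)\<^sup>2" using s by (simp only: of_nat_power) (intro power_mono, auto)
  then have "s\<^sup>2 \<le> n" by simp
  then have 1: "(2 * m - 1)\<^sup>2 \<le> n" using m(2) by (meson order_trans power_mono zero_le)
  have "real s + 1 \<le> 3 * real m" using m(3) by linarith
  then have "sqrt n \<le> 3 * real m" using s by linarith
  then have "sqrt n ^ 3 \<le> (3 * real m) ^ 3" by (intro power_mono) auto
  moreover have "real n powr (3 / 2) = sqrt n ^ 3"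
    using assms by (simp add: powr_half_sqrt[symmetric] powr_powr flip: powr_numeral)
  ultimately have "real n powr (3 / 2) \<le> 27 * real m ^ 3"
    by (simp add: power_mult_distrib)
  with 1 m(1) show ?thesis by blast
qed

lemma rich_pencils_exist:
  assumes "n \<ge> 1"
  shows "\<exists>\<L>. (\<forall>i<4. is_pencil n (span {centre i}) (\<L> i)) \<and>
           real (card (rich4_points \<L>)) \<ge> 1 / 54 * real n powr (3 / 2)"
proof -
  obtain m where m: "m \<ge> 1" "(2 * m - 1)\<^sup>2 \<le> n" "real n powr (3 / 2) \<le> 27 * real m ^ 3"
    using exists_grid_size[OF assms] by blast
  let ?X = "triple_vec ` coprime_triples m"
  have "\<exists>\<L>. is_pencil n (span {centre i}) \<L> \<and> (\<forall>x\<in>?X. \<exists>L\<in>\<L>. span {x} \<subseteq> L)" if "i < 4" for i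
    using card_normals_le[OF that m(1)] m(2) assms finite_coprime_triples
    by (intro pencil_covering_exists centre_nonzero[OF that]) auto
  then obtain \<L> where \<L>: "is_pencil n (span {centre i}) (\<L> i)"
    "\<forall>x\<in>?X. \<exists>L\<in>\<L> i. span {x} \<subseteq> L" if "i < 4" for i
    by metis
  have nonzero: "triple_vec t \<noteq> 0" if "t \<in> coprime_triples m" for t
    using that by (auto simp: coprime_triples_def triple_vec_def vec_eq_iff forall_3)
  have "(\<lambda>t. span {triple_vec t}) ` coprime_triples m \<subseteq> rich4_points \<L>"
    using \<L>(2) nonzero by (auto simp: rich4_points_def span_in_proj_points)
  moreover have "finite (rich4_points \<L>)"
    using \<L>(1) finite_rich4_points[OF _ general_position_centres] by blast
  ultimately have "card (coprime_triples m) \<le> card (rich4_points \<L>)"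
    by (metis card_image card_mono inj_on_span_coprime_triples)
  then have "real m ^ 3 / 2 \<le> real (card (rich4_points \<L>))"
    using card_coprime_triples_ge[OF m(1)] by linarith
  \<comment> \<open>The constant is 54 = 2 * 27: the factor 2 is the loss to non-coprime triples, 27
    the loss in rounding the grid size.\<close>
  then have "1 / 54 * real n powr (3 / 2) \<le> real (card (rich4_points \<L>))"
    using m(3) by linarith
  then show ?thesis using \<L>(1) by blast
qed

theorem theorem3:
  "\<exists>c::real. c > 0 \<and>
     (\<forall>n::nat. n \<ge> 1 \<longrightarrow>
       (\<exists>(p :: nat \<Rightarrow> (real ^ 3) set) (\<L> :: nat \<Rightarrow> (real ^ 3) set set).
          (\<forall>i<4. is_pencil n (p i) (\<L> i)) \<and>
          general_position4 p \<and>
          real (card (rich4_points \<L>)) \<ge> c * real n powr (3 / 2)))"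
proof (intro exI[of _ "1 / 54"] conjI allI impI)
  fix n :: nat assume "n \<ge> 1"
  then show "\<exists>(p :: nat \<Rightarrow> (real ^ 3) set) (\<L> :: nat \<Rightarrow> (real ^ 3) set set).
          (\<forall>i<4. is_pencil n (p i) (\<L> i)) \<and>
          general_position4 p \<and>
          real (card (rich4_points \<L>)) \<ge> 1 / 54 * real n powr (3 / 2)"
    using rich_pencils_exist general_position_centres by meson
qed simp

end
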